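(* Let $G$ be a discrete group with identity $e$, $p\in[1,\infty)$, and let $(\{f_g\}_{g\in G},\{\tau_g\}_{g\in G})$ be a $p$-USF for a Banach space $\mathcal{X}$. Then there is an invertible isometric representation $\pi$ of $G$ on $\mathcal{X}$ for which $$\tau_g=\pi_g\tau_e,\quad f_g=f_e\pi_{g^{-1}},\quad\forall g\in G,$$ if and only if $$f_{ug}(\tau_{uh})=f_g(\tau_h),\quad\forall u,g,h\in G.$$ Moreover, in this case the representation can be defined as $\pi_g:=\theta_\tau\lambda_g\theta_f$ for all $g\in G$.
   Context: Banach spaces are over $\mathbb{C}$ and separable; $\mathcal{X}^*$ is the dual of $\mathcal{X}$. A discrete group is a countable group with the discrete topology (not necessarily abelian). $\mathcal{II}(\mathcal{X})$ is the set of invertible (surjective) linear isometries of $\mathcal{X}$. An invertible isometric representation of a discrete group $G$ on $\mathcal{X}$ is a group homomorphism $\pi:G\to\mathcal{II}(\mathcal{X})$, $g\mapsto\pi_g$. $\{\delta_g\}_{g\in G}$ is the standard Schauder basis of $\ell^p(G)$. The $p$-left regular representation $\lambda:G\to\mathcal{II}(\ell^p(G))$ is determined by $\lambda_g\delta_h=\delta_{gh}$ for all $g,h\in G$. An unconditional Schauder frame (USF) for $\mathcal{X}$ is a pair $(\{f_g\}_{g\in G},\{\tau_g\}_{g\in G})$ with $f_g\in\mathcal{X}^*$, $\tau_g\in\mathcal{X}$ such that $x=\sum_{g\in G}f_g(x)\tau_g$ for all $x\in\mathcal{X}$, with unconditional convergence. A USF is a $p$-USF if (i) the analysis operator $\theta_f:\mathcal{X}\to\ell^p(G)$,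 $\theta_fx=\{f_g(x)\}_{g\in G}$, is a well-defined isometry, and (ii) the synthesis operator $\theta_\tau:\ell^p(G)\to\mathcal{X}$, $\theta_\tau\{a_g\}_{g\in G}=\sum_{g\in G}a_g\tau_g$, is a well-defined bounded linear operator. *)

theory Defs
  imports "HOL-Analysis.Analysis" "HOL-Algebra.Group"
begin

text \<open>Complex Banach spaces: the library's class of real Banach spaces together with a complex
  scalar multiplication that extends the real one and is compatible with the norm.\<close>

class complex_banach = banach +
  fixes scaleC :: "complex \<Rightarrow> 'a \<Rightarrow> 'a" (infixr "*\<^sub>C" 75)
  assumes scaleC_add_right: "a *\<^sub>C (x + y) = a *\<^sub>C x + a *\<^sub>C y"
    and scaleC_add_left: "(a + b) *\<^sub>C x = a *\<^sub>C x + b *\<^sub>C x"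
    and scaleC_scaleC: "a *\<^sub>C (b *\<^sub>C x) = (a * b) *\<^sub>C x"
    and scaleC_of_real: "complex_of_real r *\<^sub>C x = r *\<^sub>R x"
    and norm_scaleC: "norm (a *\<^sub>C x) = cmod a * norm x"

lemma scaleC_one: "1 *\<^sub>C (x::'a::complex_banach) = x"
  using scaleC_of_real[of 1 x] by simp

instantiation complex :: complex_banach
begin

definition scaleC_complex :: "complex \<Rightarrow> complex \<Rightarrow> complex"
  where "scaleC_complex a x = a * x"

instance
  by standard (auto simp: scaleC_complex_def algebra_simps norm_mult scaleR_conv_of_real)

end

definition clinear :: "('x::complex_banach \<Rightarrow> 'y::complex_banach) \<Rightarrow> bool"
  where "clinear T \<longleftrightarrow> Vector_Spaces.linear scaleC scaleC T"

lemma clinear_iff: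
  "clinear T \<longleftrightarrow> (\<forall>x y. T (x + y) = T x + T y) \<and> (\<forall>c x. T (c *\<^sub>C x) = c *\<^sub>C T x)"
proof -
  have "vector_space (scaleC :: complex \<Rightarrow> 'c::complex_banach \<Rightarrow> 'c)"
    by standard (auto simp: scaleC_add_right scaleC_add_left scaleC_scaleC scaleC_one)
  moreover have "vector_space (scaleC :: complex \<Rightarrow> 'd::complex_banach \<Rightarrow> 'd)"
    by standard (auto simp: scaleC_add_right scaleC_add_left scaleC_scaleC scaleC_one)
  ultimately show ?thesis
    unfolding clinear_def Vector_Spaces.linear_iff by auto
qed

definition dual_space :: "('x::complex_banach \<Rightarrow> complex) set"
  where "dual_space = {\<phi>. clinear \<phi> \<and> bounded_linear \<phi>}"

definition invertible_isometries :: "('x::complex_banach \<Rightarrow> 'x) set"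
  where "invertible_isometries = {T. clinear T \<and> (\<forall>x. norm (T x) = norm x) \<and> surj T}"

definition isometry_group :: "('x::complex_banach \<Rightarrow> 'x) monoid"
  where "isometry_group = \<lparr>carrier = invertible_isometries, mult = (\<circ>), one = id\<rparr>"

lemma group_isometry_group: "group (isometry_group :: ('x::complex_banach \<Rightarrow> 'x) monoid)"
proof (rule groupI)
  fix T :: "'x \<Rightarrow> 'x" assume "T \<in> carrier isometry_group"
  then have T: "\<And>x y. T (x + y) = T x + T y" "\<And>c x. T (c *\<^sub>C x) = c *\<^sub>C T x"
      "\<And>x. norm (T x) = norm x" "surj T"
    by (auto simp: isometry_group_def invertible_isometries_def clinear_iff)
  have diff: "T (x - y) = T x - T y" for x y
    using T(1)[of "x - y" y] by simp
  have "inj T"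
  proof (rule injI)
    fix x y assume "T x = T y"
    then have "norm (T (x - y)) = 0" by (simp add: diff)
    then show "x = y" by (simp add: T(3))
  qed
  define S where "S = inv_into UNIV T"
  have ST: "S (T x) = x" and TS: "T (S x) = x" for x
    using \<open>inj T\<close> \<open>surj T\<close> by (auto simp: S_def surj_f_inv_f)
  have "S (x + y) = S x + S y" for x y by (metis ST TS T(1))
  moreover have "S (c *\<^sub>C x) = c *\<^sub>C S x" for c x by (metis ST TS T(2))
  moreover have "norm (S x) = norm x" for x by (metis TS T(3))
  moreover have "surj S" by (metis ST surjI)
  ultimately have "S \<in> carrier isometry_group"
    by (auto simp: isometry_group_def invertible_isometries_def clinear_iff)
  moreover have "S \<otimes>\<^bsub>isometry_group\<^esub> T = \<one>\<^bsub>isometry_group\<^esub>"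
    by (auto simp: isometry_group_def ST)
  ultimately show "\<exists>S\<in>carrier isometry_group. S \<otimes>\<^bsub>isometry_group\<^esub> T = \<one>\<^bsub>isometry_group\<^esub>"
    by blast
qed (auto simp: isometry_group_def invertible_isometries_def clinear_iff, metis surjD rangeI)

definition invertible_isometric_rep ::
    "('g, 'b) monoid_scheme \<Rightarrow> ('g \<Rightarrow> 'x::complex_banach \<Rightarrow> 'x) \<Rightarrow> bool"
  where "invertible_isometric_rep G \<pi> \<longleftrightarrow> \<pi> \<in> hom G isometry_group"

text \<open>Elements of \<open>\<ell>\<^sup>p(G)\<close> are functions on the whole type that vanish outside the carrier,
  so that a vector has exactly one representation.\<close>

definition ellp :: "real \<Rightarrow> ('g, 'b) monoid_scheme \<Rightarrow> ('g \<Rightarrow> complex) set"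
  where "ellp p G =
    {a. (\<forall>g. g \<notin> carrier G \<longrightarrow> a g = 0) \<and> (\<lambda>g. cmod (a g) powr p) summable_on carrier G}"

definition ellp_norm :: "real \<Rightarrow> ('g, 'b) monoid_scheme \<Rightarrow> ('g \<Rightarrow> complex) \<Rightarrow> real"
  where "ellp_norm p G a = (\<Sum>\<^sub>\<infinity>g\<in>carrier G. cmod (a g) powr p) powr (1 / p)"

definition delta :: "'g \<Rightarrow> 'g \<Rightarrow> complex"
  where "delta h = (\<lambda>k. if k = h then 1 else 0)"

definition left_regular :: "('g, 'b) monoid_scheme \<Rightarrow> 'g \<Rightarrow> ('g \<Rightarrow> complex) \<Rightarrow> 'g \<Rightarrow> complex"
  where "left_regular G g a =
    (\<lambda>k. if k \<in> carrier G then a (inv\<^bsub>G\<^esub> g \<otimes>\<^bsub>G\<^esub> k) else 0)"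

text \<open>The coordinate formula above is the isometric linear extension of
  \<open>\<delta>\<^sub>h \<mapsto> \<delta>\<^sub>g\<^sub>h\<close>, as the following two lemmas confirm.\<close>

lemma left_regular_delta:
  assumes "group G" "g \<in> carrier G" "h \<in> carrier G"
  shows "left_regular G g (delta h) = delta (g \<otimes>\<^bsub>G\<^esub> h)"
proof -
  interpret group G by fact
  have "inv\<^bsub>G\<^esub> g \<otimes>\<^bsub>G\<^esub> k = h \<longleftrightarrow> k = g \<otimes>\<^bsub>G\<^esub> h" if "k \<in> carrier G" for k
    using assms that by (metis inv_solve_left)
  then show ?thesis
    using assms by (auto simp: left_regular_def delta_def fun_eq_iff)
qed

lemma left_regular_isometric:
  assumes "group G" "g \<in> carrier G" "a \<in> ellp p G"
  shows "left_regular G g a \<in> ellp p G" "ellp_norm p G (left_regular G g a) = ellp_norm p G a"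
proof -
  interpret group G by fact
  have bij: "bij_betw (\<lambda>k. inv\<^bsub>G\<^esub> g \<otimes>\<^bsub>G\<^esub> k) (carrier G) (carrier G)"
    by (rule bij_betw_byWitness[where f' = "\<lambda>k. g \<otimes>\<^bsub>G\<^esub> k"])
       (use assms in \<open>auto simp: m_assoc[symmetric]\<close>)
  have "(\<lambda>k. cmod (left_regular G g a k) powr p) summable_on carrier G \<longleftrightarrow>
        (\<lambda>k. cmod (a (inv\<^bsub>G\<^esub> g \<otimes>\<^bsub>G\<^esub> k)) powr p) summable_on carrier G"
    by (rule summable_on_cong) (simp add: left_regular_def)
  also have "\<dots> \<longleftrightarrow> (\<lambda>k. cmod (a k) powr p) summable_on carrier G"
    by (rule summable_on_reindex_bij_betw[OF bij])
  finally show "left_regular G g a \<in> ellp p G"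
    using assms(3) by (auto simp: ellp_def left_regular_def)
  have "(\<Sum>\<^sub>\<infinity>k\<in>carrier G. cmod (left_regular G g a k) powr p) =
        (\<Sum>\<^sub>\<infinity>k\<in>carrier G. cmod (a (inv\<^bsub>G\<^esub> g \<otimes>\<^bsub>G\<^esub> k)) powr p)"
    by (rule infsum_cong) (simp add: left_regular_def)
  also have "\<dots> = (\<Sum>\<^sub>\<infinity>k\<in>carrier G. cmod (a k) powr p)"
    by (rule infsum_reindex_bij_betw[OF bij])
  finally show "ellp_norm p G (left_regular G g a) = ellp_norm p G a"
    by (simp add: ellp_norm_def)
qed

definition analysis_op ::
    "('g, 'b) monoid_scheme \<Rightarrow> ('g \<Rightarrow> 'x \<Rightarrow> complex) \<Rightarrow> 'x \<Rightarrow> 'g \<Rightarrow> complex"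
  where "analysis_op G f x = (\<lambda>g. if g \<in> carrier G then f g x else 0)"

definition synthesis_op ::
    "('g, 'b) monoid_scheme \<Rightarrow> ('g \<Rightarrow> 'x::complex_banach) \<Rightarrow> ('g \<Rightarrow> complex) \<Rightarrow> 'x"
  where "synthesis_op G \<tau> a = (\<Sum>\<^sub>\<infinity>g\<in>carrier G. a g *\<^sub>C \<tau> g)"

text \<open>\<^const>\<open>has_sum\<close> is convergence of the net of finite partial sums, that is, unconditional
  convergence.\<close>

definition USF ::
    "('g, 'b) monoid_scheme \<Rightarrow> ('g \<Rightarrow> 'x::complex_banach \<Rightarrow> complex) \<Rightarrow> ('g \<Rightarrow> 'x) \<Rightarrow> bool"
  where "USF G f \<tau> \<longleftrightarrow>
    (\<forall>g\<in>carrier G. f g \<in> dual_space) \<and>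
    (\<forall>x. ((\<lambda>g. f g x *\<^sub>C \<tau> g) has_sum x) (carrier G))"

text \<open>Linearity of the analysis operator is automatic, so isometry is norm preservation.
  For the synthesis operator, well-definedness is summability of the defining series;
  a value of \<^const>\<open>infsum\<close> alone would not express it.\<close>

definition p_USF ::
    "real \<Rightarrow> ('g, 'b) monoid_scheme \<Rightarrow> ('g \<Rightarrow> 'x::complex_banach \<Rightarrow> complex) \<Rightarrow> ('g \<Rightarrow> 'x) \<Rightarrow> bool"
  where "p_USF p G f \<tau> \<longleftrightarrow>
    USF G f \<tau> \<and>
    (\<forall>x. analysis_op G f x \<in> ellp p G \<and> ellp_norm p G (analysis_op G f x) = norm x) \<and>
    (\<forall>a\<in>ellp p G. (\<lambda>g. a g *\<^sub>C \<tau> g) summable_on carrier G) \<and>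
    (\<forall>a\<in>ellp p G. \<forall>b\<in>ellp p G.
      synthesis_op G \<tau> (\<lambda>g. a g + b g) = synthesis_op G \<tau> a + synthesis_op G \<tau> b) \<and>
    (\<forall>c. \<forall>a\<in>ellp p G. synthesis_op G \<tau> (\<lambda>g. c * a g) = c *\<^sub>C synthesis_op G \<tau> a) \<and>
    (\<exists>C. \<forall>a\<in>ellp p G. norm (synthesis_op G \<tau> a) \<le> C * ellp_norm p G a)"

definition generated_by_rep ::
    "('g, 'b) monoid_scheme \<Rightarrow> ('g \<Rightarrow> 'x \<Rightarrow> complex) \<Rightarrow> ('g \<Rightarrow> 'x) \<Rightarrow> ('g \<Rightarrow> 'x \<Rightarrow> 'x) \<Rightarrow> bool"
  where "generated_by_rep G f \<tau> \<pi> \<longleftrightarrow>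
    (\<forall>g\<in>carrier G. \<tau> g = \<pi> g (\<tau> \<one>\<^bsub>G\<^esub>) \<and> f g = f \<one>\<^bsub>G\<^esub> \<circ> \<pi> (inv\<^bsub>G\<^esub> g))"

end

theory Submission
  imports Defs
begin

text \<open>Write \<open>\<pi>\<^sub>g = \<theta>\<^sub>\<tau> \<lambda>\<^sub>g \<theta>\<^sub>f\<close>. If a representation generates the frame, then
  \<open>f\<^sub>u\<^sub>g(\<tau>\<^sub>u\<^sub>h) = f\<^sub>e(\<pi>((ug)\<^sup>-\<^sup>1 (uh)) \<tau>\<^sub>e)\<close>, in which the \<open>u\<close>
  cancels: this is \<open>generated_frame_left_invariant\<close>.

  The converse rests on the intertwining relation \<open>\<theta>\<^sub>f \<pi>\<^sub>g = \<lambda>\<^sub>g \<theta>\<^sub>f\<close>,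
  which is lemma \<open>coordinate_translation\<close>. The reconstruction formula makes \<open>\<theta>\<^sub>f\<close>
  injective, so the relation says that \<open>\<pi>\<^sub>g\<close> is the restriction of \<open>\<lambda>\<^sub>g\<close> to the
  range of \<open>\<theta>\<^sub>f\<close>, carried back to the Banach space. All the properties required of \<open>\<pi>\<close> are
  then inherited from \<open>\<lambda>\<close> coordinate by coordinate: it is linear, multiplicative and sends the
  identity to the identity, hence is invertible, and it preserves the norm because both
  \<open>\<theta>\<^sub>f\<close> and \<open>\<lambda>\<^sub>g\<close> do. The formulas for \<open>\<tau>\<^sub>g\<close> and
  \<open>f\<^sub>g\<close> are also identities between coordinates.\<close>

lemma generated_frame_left_invariant:
  assumes "group G" and rep: "invertible_isometric_rep G \<pi>" and gen: "generated_by_rep G f \<tau> \<pi>"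
    and u: "u \<in> carrier G" and g: "g \<in> carrier G" and h: "h \<in> carrier G"
  shows "f (u \<otimes>\<^bsub>G\<^esub> g) (\<tau> (u \<otimes>\<^bsub>G\<^esub> h)) = f g (\<tau> h)"
proof -
  interpret group G by fact
  have mult: "\<pi> a (\<pi> b x) = \<pi> (a \<otimes>\<^bsub>G\<^esub> b) x" if "a \<in> carrier G" "b \<in> carrier G" for a b x
    using rep that by (auto simp: invertible_isometric_rep_def isometry_group_def hom_def)
  have pair: "f a (\<tau> b) = f \<one>\<^bsub>G\<^esub> (\<pi> (inv\<^bsub>G\<^esub> a \<otimes>\<^bsub>G\<^esub> b) (\<tau> \<one>\<^bsub>G\<^esub>))"
    if a: "a \<in> carrier G" and b: "b \<in> carrier G" for a b
  proof -
    have "\<tau> b = \<pi> b (\<tau> \<one>\<^bsub>G\<^esub>)" and "f a = f \<one>\<^bsub>G\<^esub> \<circ> \<pi> (inv\<^bsub>G\<^esub> a)"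
      using gen a b unfolding generated_by_rep_def by blast+
    then have "f a (\<tau> b) = f \<one>\<^bsub>G\<^esub> (\<pi> (inv\<^bsub>G\<^esub> a) (\<pi> b (\<tau> \<one>\<^bsub>G\<^esub>)))"
      by (metis comp_apply)
    then show ?thesis using a b by (simp add: mult)
  qed
  have "inv\<^bsub>G\<^esub> (u \<otimes>\<^bsub>G\<^esub> g) \<otimes>\<^bsub>G\<^esub> (u \<otimes>\<^bsub>G\<^esub> h) = inv\<^bsub>G\<^esub> g \<otimes>\<^bsub>G\<^esub> h"
  proof -
    have "inv\<^bsub>G\<^esub> u \<otimes>\<^bsub>G\<^esub> (u \<otimes>\<^bsub>G\<^esub> h) = h"
      using u h by (simp add: m_assoc[symmetric])
    then show ?thesis using u g h by (simp add: inv_mult_group m_assoc)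
  qed
  then show ?thesis using u g h by (simp add: pair)
qed

locale left_invariant_p_frame = group G
  for G :: "('g, 'b) monoid_scheme" (structure) +
  fixes p :: real and f :: "'g \<Rightarrow> 'x::complex_banach \<Rightarrow> complex" and \<tau> :: "'g \<Rightarrow> 'x"
  assumes frame: "p_USF p G f \<tau>"
    and left_invariant: "\<lbrakk>u \<in> carrier G; g \<in> carrier G; h \<in> carrier G\<rbrakk>
      \<Longrightarrow> f (u \<otimes> g) (\<tau> (u \<otimes> h)) = f g (\<tau> h)"
begin

definition translation :: "'g \<Rightarrow> 'x \<Rightarrow> 'x"
  where "translation g = synthesis_op G \<tau> \<circ> left_regular G g \<circ> analysis_op G f"

lemma reconstruction: "((\<lambda>g. f g x *\<^sub>C \<tau> g) has_sum x) (carrier G)"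
  using frame by (simp add: p_USF_def USF_def)

lemma coordinate_clinear: "g \<in> carrier G \<Longrightarrow> clinear (f g)"
  and coordinate_bounded_linear: "g \<in> carrier G \<Longrightarrow> bounded_linear (f g)"
  using frame by (auto simp: p_USF_def USF_def dual_space_def)

lemma coordinate_scaleC: "g \<in> carrier G \<Longrightarrow> f g (c *\<^sub>C x) = c * f g x"
  using coordinate_clinear by (simp add: clinear_iff scaleC_complex_def)

lemma coordinate_add: "g \<in> carrier G \<Longrightarrow> f g (x + y) = f g x + f g y"
  using coordinate_clinear by (simp add: clinear_iff)

lemma analysis_op_ellp: "analysis_op G f x \<in> ellp p G"
  and analysis_op_isometric: "ellp_norm p G (analysis_op G f x) = norm x"
  using frame by (auto simp: p_USF_def)

lemma vector_eq_if_coordinates_eq: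
  assumes "\<And>g. g \<in> carrier G \<Longrightarrow> f g x = f g y"
  shows "x = y"
proof -
  have "((\<lambda>g. f g x *\<^sub>C \<tau> g) has_sum y) (carrier G)"
    using reconstruction[of y] assms by (simp cong: has_sum_cong)
  then show ?thesis using reconstruction has_sum_unique by blast
qed

text \<open>Applying the functional \<open>f\<^sub>k\<close> to the series \<open>\<Sum>\<^sub>j f(g\<^sup>-\<^sup>1 j)(x) \<tau>\<^sub>j\<close>
  that defines \<open>\<pi>\<^sub>g x\<close> and moving \<open>g\<^sup>-\<^sup>1\<close> into both indices of \<open>f\<^sub>k(\<tau>\<^sub>j)\<close>
  gives the reconstruction series of \<open>x\<close>, translated by \<open>g\<^sup>-\<^sup>1\<close>, under the functional
  with index \<open>g\<^sup>-\<^sup>1 k\<close>.\<close>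

lemma coordinate_translation:
  assumes g: "g \<in> carrier G" and k: "k \<in> carrier G"
  shows "f k (translation g x) = f (inv g \<otimes> k) x"
proof -
  define a where "a = left_regular G g (analysis_op G f x)"
  have "a \<in> ellp p G"
    unfolding a_def using g analysis_op_ellp by (intro left_regular_isometric is_group)
  then have "((\<lambda>j. a j *\<^sub>C \<tau> j) has_sum translation g x) (carrier G)"
    using frame by (simp add: p_USF_def translation_def synthesis_op_def a_def)
  from has_sum_bounded_linear[OF coordinate_bounded_linear[OF k] this]
  have image_sum: "((\<lambda>j. f k (a j *\<^sub>C \<tau> j)) has_sum f k (translation g x)) (carrier G)"
    by (simp add: o_def)
  have term_eq: "f k (a j *\<^sub>C \<tau> j) =
      f (inv g \<otimes> k) (f (inv g \<otimes> j) x *\<^sub>C \<tau> (inv g \<otimes> j))" if j: "j \<in> carrier G" for j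
    using left_invariant[of "inv g" k j] g k j
    by (simp add: coordinate_scaleC a_def left_regular_def analysis_op_def)
  have bij: "bij_betw (\<lambda>j. inv g \<otimes> j) (carrier G) (carrier G)"
    by (rule bij_betw_byWitness[where f' = "\<lambda>j. g \<otimes> j"])
       (use g in \<open>auto simp: m_assoc[symmetric]\<close>)
  have "((\<lambda>j. f (inv g \<otimes> k) (f j x *\<^sub>C \<tau> j)) has_sum f (inv g \<otimes> k) x) (carrier G)"
    using has_sum_bounded_linear[OF coordinate_bounded_linear reconstruction] g k
    by (simp add: o_def)
  then have "((\<lambda>j. f (inv g \<otimes> k) (f (inv g \<otimes> j) x *\<^sub>C \<tau> (inv g \<otimes> j)))
      has_sum f (inv g \<otimes> k) x) (carrier G)"
    by (simp add: has_sum_reindex_bij_betw[OF bij, of "\<lambda>j. f (inv g \<otimes> k) (f j x *\<^sub>C \<tau> j)"])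
  then have "((\<lambda>j. f k (a j *\<^sub>C \<tau> j)) has_sum f (inv g \<otimes> k) x) (carrier G)"
    using term_eq by (simp cong: has_sum_cong)
  with image_sum show ?thesis by (rule has_sum_unique)
qed

lemma analysis_translation:
  assumes "g \<in> carrier G"
  shows "analysis_op G f (translation g x) = left_regular G g (analysis_op G f x)"
  using assms by (auto simp: analysis_op_def left_regular_def coordinate_translation)

lemma norm_translation:
  assumes "g \<in> carrier G"
  shows "norm (translation g x) = norm x"
proof -
  have "norm (translation g x) = ellp_norm p G (left_regular G g (analysis_op G f x))"
    using assms by (simp flip: analysis_op_isometric analysis_translation)
  also have "\<dots> = norm x"
    using left_regular_isometric(2)[OF is_group assms analysis_op_ellp]
    by (simp add: analysis_op_isometric)
  finally show ?thesis .
qed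

lemma translation_mult:
  assumes "g \<in> carrier G" "h \<in> carrier G"
  shows "translation (g \<otimes> h) x = translation g (translation h x)"
  using assms
  by (intro vector_eq_if_coordinates_eq) (simp add: coordinate_translation inv_mult_group m_assoc)

lemma translation_one: "translation \<one> x = x"
  by (intro vector_eq_if_coordinates_eq) (simp add: coordinate_translation)

lemma clinear_translation:
  assumes "g \<in> carrier G"
  shows "clinear (translation g)"
  unfolding clinear_iff using assms
  by (auto intro!: vector_eq_if_coordinates_eq
      simp: coordinate_translation coordinate_add coordinate_scaleC)

lemma translation_invertible_isometry:
  assumes g: "g \<in> carrier G"
  shows "translation g \<in> invertible_isometries"
proof -
  have "translation g (translation (inv g) x) = x" for x
    using g by (simp add: translation_mult[symmetric] translation_one)
  then have "surj (translation g)" by (rule surjI)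
  then show ?thesis
    using g by (simp add: invertible_isometries_def clinear_translation norm_translation)
qed

lemma translation_rep: "invertible_isometric_rep G translation"
  by (auto simp: invertible_isometric_rep_def isometry_group_def hom_def
      translation_invertible_isometry translation_mult)

lemma translation_generates: "generated_by_rep G f \<tau> translation"
  unfolding generated_by_rep_def
proof (intro ballI conjI)
  fix g assume g: "g \<in> carrier G"
  show "\<tau> g = translation g (\<tau> \<one>)"
  proof (rule vector_eq_if_coordinates_eq)
    fix k assume k: "k \<in> carrier G"
    have "f k (\<tau> g) = f (inv g \<otimes> k) (\<tau> \<one>)"
      using left_invariant[of "inv g" k g] g k by simp
    then show "f k (\<tau> g) = f k (translation g (\<tau> \<one>))"
      using g k by (simp add: coordinate_translation)
  qed
  show "f g = f \<one> \<circ> translation (inv g)"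
    using g by (simp add: fun_eq_iff coordinate_translation)
qed

end

theorem theorem2p11:
  fixes G :: "('g, 'b) monoid_scheme"
    and f :: "'g \<Rightarrow> 'x::complex_banach \<Rightarrow> complex"
    and \<tau> :: "'g \<Rightarrow> 'x"
    and p :: real
  assumes "group G" and "countable (carrier G)"
    and "separable_space (euclidean :: 'x topology)"
    and "1 \<le> p"
    and "p_USF p G f \<tau>"
  shows "((\<exists>\<pi>. invertible_isometric_rep G \<pi> \<and> generated_by_rep G f \<tau> \<pi>) \<longleftrightarrow>
          (\<forall>u\<in>carrier G. \<forall>g\<in>carrier G. \<forall>h\<in>carrier G.
             f (u \<otimes>\<^bsub>G\<^esub> g) (\<tau> (u \<otimes>\<^bsub>G\<^esub> h)) = f g (\<tau> h))) \<and>
         ((\<exists>\<pi>. invertible_isometric_rep G \<pi> \<and> generated_by_rep G f \<tau> \<pi>) \<longrightarrow>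
          (let \<pi> = (\<lambda>g. synthesis_op G \<tau> \<circ> left_regular G g \<circ> analysis_op G f)
           in invertible_isometric_rep G \<pi> \<and> generated_by_rep G f \<tau> \<pi>))"
    (is "(?generated \<longleftrightarrow> ?invariant) \<and> (?generated \<longrightarrow> ?canonical)")
proof -
  have "?invariant" if ?generated
    using that generated_frame_left_invariant[OF assms(1)] by blast
  moreover have "?canonical" if ?invariant
  proof -
    interpret left_invariant_p_frame G p f \<tau>
      using assms(1,5) that
      by (simp add: left_invariant_p_frame_def left_invariant_p_frame_axioms_def)
    have "translation = (\<lambda>g. synthesis_op G \<tau> \<circ> left_regular G g \<circ> analysis_op G f)"
      by (simp add: fun_eq_iff translation_def)
    then show ?thesis
      using translation_rep translation_generates by (simp add: Let_def)
  qed
  moreover have "?generated" if ?canonical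
    using that unfolding Let_def by blast
  ultimately show ?thesis by blast
qed

end
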